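(* Let $n\geq 1$ and suppose $\omega^0_1>0,\ \ldots,\ \omega^0_n>0$ are linearly independent over the rationals. Then there exist a neighborhood $\mathcal{N}$ of $\omega^0=(\omega^0_1,\ldots,\omega^0_n)$ in $\mathbb{R}^n$ and a smooth mapping $$H:\mathcal{N}\to\mathbb{R}^n\times\mathbb{R}^n,\qquad H(\omega)=(\tau(\omega),A(\omega))=\big((\tau_1(\omega),\ldots,\tau_n(\omega)),(a_1(\omega),\ldots,a_n(\omega))\big),$$ such that, for all $\omega=(\omega_1,\ldots,\omega_n)\in\mathcal{N}$, $$\sum_{k=1}^n a_k(\omega)\,e^{-i\omega_j\tau_k(\omega)}=i\omega_j\quad\text{and}\quad \sum_{k=1}^n a_k(\omega)\,e^{i\omega_j\tau_k(\omega)}=-i\omega_j,\qquad j=1,\ldots,n.$$ *)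

theory Defs
  imports "HOL-Analysis.Analysis"
begin

text \<open>
  Linear independence over the rationals of the coordinates of \<open>w\<close>, as an indexed family:
  the library's \<open>module.dependent\<close> speaks about sets, so injectivity is needed to exclude
  repeated coordinates.
\<close>

definition rat_independent_coords :: "real ^ 'n \<Rightarrow> bool" where
  "rat_independent_coords w \<longleftrightarrow>
     inj (\<lambda>j. w $ j) \<and>
     \<not> module.dependent (\<lambda>(q::rat) (x::real). of_rat q * x) (range (\<lambda>j. w $ j))"

lemma vector_space_rat_real: "vector_space (\<lambda>(q::rat) (x::real). of_rat q * x)"
  by unfold_locales (simp_all add: algebra_simps of_rat_add of_rat_mult)

lemma rat_independent_coords_iff:
  fixes w :: "real ^ 'n"
  shows "rat_independent_coords w \<longleftrightarrow>
    (\<forall>q :: 'n \<Rightarrow> rat. (\<Sum>j\<in>UNIV. of_rat (q j) * w $ j) = 0 \<longrightarrow> (\<forall>j. q j = 0))"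
    (is "_ \<longleftrightarrow> ?R")
proof -
  interpret Q: vector_space "\<lambda>(q::rat) (x::real). of_rat q * x"
    by (rule vector_space_rat_real)
  let ?c = "\<lambda>j. w $ j"
  show ?thesis
  proof
    assume L: "rat_independent_coords w"
    then have inj: "inj ?c" and ind: "Q.independent (range ?c)"
      by (simp_all add: rat_independent_coords_def)
    show ?R
    proof (intro allI impI)
      fix q :: "'n \<Rightarrow> rat" and j
      assume 0: "(\<Sum>j\<in>UNIV. of_rat (q j) * w $ j) = 0"
      have "(\<Sum>x\<in>range ?c. of_rat (q (inv ?c x)) * x) = 0"
        using 0 by (simp add: sum.reindex[OF inj] inv_f_f[OF inj])
      from Q.independentD[OF ind _ order_refl this, of "w $ j"]
      show "q j = 0" by (simp add: inv_f_f[OF inj])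
    qed
  next
    assume R: ?R
    have inj: "inj ?c"
    proof (rule injI, rule ccontr)
      fix i j assume eq: "w $ i = w $ j" and ne: "i \<noteq> j"
      define q :: "'n \<Rightarrow> rat" where "q k = (if k = i then 1 else 0) - (if k = j then 1 else 0)" for k
      have "(\<Sum>k\<in>UNIV. of_rat (q k) * w $ k) =
            (\<Sum>k\<in>UNIV. (if k = i then w $ k else 0) - (if k = j then w $ k else 0))"
        by (rule sum.cong) (auto simp: q_def of_rat_minus)
      also have "\<dots> = 0" using eq by (simp add: sum_subtractf)
      finally have "q i = 0" using R by blast
      then show False using ne by (simp add: q_def)
    qed
    have "Q.independent (range ?c)"
    proof
      assume "Q.dependent (range ?c)"
      then obtain u where u: "\<exists>v\<in>range ?c. u v \<noteq> 0"
        and 0: "(\<Sum>v\<in>range ?c. of_rat (u v) * v) = 0"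
        using Q.dependent_finite[of "range ?c"] by auto
      from 0 have "(\<Sum>j\<in>UNIV. of_rat (u (w $ j)) * w $ j) = 0"
        by (simp add: sum.reindex[OF inj])
      with R have "\<forall>j. u (w $ j) = 0" by (elim allE[of _ "\<lambda>j. u (w $ j)"]) simp
      with u show False by blast
    qed
    with inj show "rat_independent_coords w" by (simp add: rat_independent_coords_def)
  qed
qed

text \<open>
  \<open>C_on n S f\<close>: on the open set \<open>S\<close> all iterated directional derivatives of \<open>f\<close> of order at
  most \<open>n\<close> exist and are continuous, those of order less than \<open>n\<close> being even Frechet
  differentiable.  For open \<open>S\<close> and finite-dimensional domain this is the usual \<open>C^n\<close>.
\<close>

primrec C_on :: "nat \<Rightarrow> 'a::euclidean_space set \<Rightarrow> ('a \<Rightarrow> 'b::real_normed_vector) \<Rightarrow> bool" where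
  "C_on 0 S f \<longleftrightarrow> continuous_on S f"
| "C_on (Suc n) S f \<longleftrightarrow>
     (\<forall>x\<in>S. f differentiable (at x)) \<and>
     (\<forall>v. C_on n S (\<lambda>x. frechet_derivative f (at x) v))"

definition smooth_on :: "'a::euclidean_space set \<Rightarrow> ('a \<Rightarrow> 'b::real_normed_vector) \<Rightarrow> bool" where
  "smooth_on S f \<longleftrightarrow> (\<forall>n. C_on n S f)"

end

theory Submission
  imports Defs
begin

text \<open>
  In real form the system reads \<open>\<Sum>\<^sub>k a\<^sub>k cos (\<omega>\<^sub>j \<tau>\<^sub>k) = 0\<close> and \<open>\<Sum>\<^sub>k a\<^sub>k sin (\<omega>\<^sub>j \<tau>\<^sub>k) = - \<omega>\<^sub>j\<close>.
  If the phases \<open>\<omega>\<^sub>j \<tau>\<^sub>k\<close> could be prescribed freely as \<open>M\<^sub>j\<^sub>k \<pi>/2\<close> with \<open>M\<close> an invertible matrix of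
  signs, the cosines would vanish and \<open>M a = - \<omega>\<^sup>0\<close> would determine \<open>a\<close>; its entries are nonzero
  because the \<open>\<omega>\<^sup>0\<^sub>j\<close> are rationally independent. Perturbing \<open>\<tau>\<^sub>k\<close> by \<open>s\<^sub>k\<close>, the linearization of the system
  in \<open>(s, a)\<close> is then block-diagonal with invertible blocks \<open>- diag \<omega>\<^sup>0 M diag a\<close> and \<open>M\<close>, so the
  implicit function theorem gives smooth \<open>(s, a)\<close> for all nearby phases and frequencies.
  By Kronecker's theorem there are \<open>T\<^sub>k\<close> such that \<open>\<omega>\<^sup>0\<^sub>j T\<^sub>k\<close> is as close as needed to \<open>M\<^sub>j\<^sub>k \<pi>/2\<close> modulo
  \<open>2 \<pi>\<close>, and \<open>\<tau>\<^sub>k = T\<^sub>k + s\<^sub>k\<close> with the phases \<open>\<omega>\<^sub>j T\<^sub>k\<close> (shifted by fixed multiples of \<open>2 \<pi>\<close>) solves the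
  original system near \<open>\<omega>\<^sup>0\<close>.
\<close>

section \<open>Calculus of \<open>C_on\<close>\<close>

text \<open>Openness of \<open>S\<close> makes the derivative at a point of \<open>S\<close> depend
  only on values on \<open>S\<close>, so the agreement of the functions passes to their iterated
  derivatives there.\<close>

lemma C_on_cong:
  assumes "open S" "\<And>x. x \<in> S \<Longrightarrow> f x = g x" "C_on n S g"
  shows "C_on n S f"
  using assms(2,3)
proof (induction n arbitrary: f g)
  case 0
  then show ?case using continuous_on_cong by (metis C_on.simps(1))
next
  case (Suc n)
  have der: "(f has_derivative D) (at x)" if "(g has_derivative D) (at x)" "x \<in> S" for x D
    using has_derivative_transform_within_open[OF that(1) assms(1) that(2)] Suc.prems(1) by simp
  have dg: "g differentiable (at x)" if "x \<in> S" for x using Suc.prems that by simp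
  have eq: "frechet_derivative f (at x) = frechet_derivative g (at x)" if "x \<in> S" for x
    using der[OF dg[OF that, unfolded frechet_derivative_works] that] frechet_derivative_at by metis
  have "C_on n S (\<lambda>x. frechet_derivative f (at x) v)" for v
    by (rule Suc.IH[where g = "\<lambda>x. frechet_derivative g (at x) v"]) (use eq Suc.prems(2) in auto)
  moreover have "f differentiable (at x)" if "x \<in> S" for x
    using der dg that unfolding differentiable_def by blast
  ultimately show ?case by simp
qed

text \<open>By uniqueness of derivatives an explicit formula may replace
  \<open>frechet_derivative\<close>; the inductions below differentiate by the usual rules and
  conclude with this.\<close>

lemma C_on_Suc_has_derivativeI:
  assumes "open S" "\<And>x. x \<in> S \<Longrightarrow> (f has_derivative f' x) (at x)"
    and "\<And>v. C_on n S (\<lambda>x. f' x v)"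
  shows "C_on (Suc n) S f"
proof -
  have "frechet_derivative f (at x) = f' x" if "x \<in> S" for x
    using assms(2)[OF that] frechet_derivative_at by metis
  then have "C_on n S (\<lambda>x. frechet_derivative f (at x) v)" for v
    by (intro C_on_cong[OF assms(1) _ assms(3)[of v]]) simp
  then show ?thesis using assms(2) by (auto simp: differentiable_def)
qed

lemma C_on_Suc_has_derivative:
  assumes "C_on (Suc n) S f" "x \<in> S"
  shows "(f has_derivative frechet_derivative f (at x)) (at x)"
  using assms by (simp add: frechet_derivative_works[symmetric])

lemma C_on_SucD: "C_on (Suc n) S f \<Longrightarrow> C_on n S f"
proof (induction n arbitrary: f)
  case 0
  then show ?case
    by (simp add: continuous_at_imp_continuous_on differentiable_imp_continuous_within)
next
  case (Suc n)
  then show ?case by (metis C_on.simps(2))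
qed

lemma C_on_subset: "C_on n S f \<Longrightarrow> T \<subseteq> S \<Longrightarrow> C_on n T f"
  by (induction n arbitrary: f) (auto intro: continuous_on_subset)

lemma C_on_const: "open S \<Longrightarrow> C_on n S (\<lambda>x. c)"
proof (induction n arbitrary: c)
  case (Suc n)
  show ?case
    by (rule C_on_Suc_has_derivativeI[OF \<open>open S\<close> has_derivative_const]) (auto intro!: Suc)
qed simp

lemma C_on_bounded_linear:
  assumes "open S" "bounded_linear f"
  shows "C_on n S f"
proof (cases n)
  case 0
  then show ?thesis using assms by (simp add: linear_continuous_on)
next
  case (Suc m)
  then show ?thesis
    using C_on_Suc_has_derivativeI[OF assms(1) bounded_linear_imp_has_derivative[OF assms(2)]]
      C_on_const[OF assms(1)] by blast
qed

lemma C_on_add: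
  assumes "open S" "C_on n S f" "C_on n S g"
  shows "C_on n S (\<lambda>x. f x + g x)"
  using assms(2,3)
proof (induction n arbitrary: f g)
  case (Suc n)
  show ?case
    by (rule C_on_Suc_has_derivativeI[OF assms(1) has_derivative_add[OF
          C_on_Suc_has_derivative[OF Suc.prems(1)] C_on_Suc_has_derivative[OF Suc.prems(2)]]])
      (use Suc in auto)
qed (auto intro: continuous_on_add)

lemma C_on_sum:
  assumes "open S" "\<And>i. i \<in> I \<Longrightarrow> C_on n S (f i)"
  shows "C_on n S (\<lambda>x. \<Sum>i\<in>I. f i x)"
  using assms(2)
  by (induction I rule: infinite_finite_induct) (auto intro!: C_on_const C_on_add assms(1))

text \<open>The product rule expresses the derivative through \<open>f\<close>, \<open>g\<close> and
  their derivatives, all of class \<open>n\<close>; for \<open>f\<close> and \<open>g\<close>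
  themselves this is \<open>C_on_SucD\<close>.\<close>

lemma C_on_bilinear:
  assumes "bounded_bilinear B" "open S" "C_on n S f" "C_on n S g"
  shows "C_on n S (\<lambda>x. B (f x) (g x))"
  using assms(3,4)
proof (induction n arbitrary: f g)
  case 0
  then show ?case using bounded_bilinear.continuous_on[OF assms(1)] by auto
next
  case (Suc n)
  note IH = Suc.IH
  have fn: "C_on n S f" "C_on n S g" using Suc.prems C_on_SucD by auto
  show ?case
    by (rule C_on_Suc_has_derivativeI[OF assms(2)
          bounded_bilinear.FDERIV[OF assms(1) C_on_Suc_has_derivative[OF Suc.prems(1)]
            C_on_Suc_has_derivative[OF Suc.prems(2)]]])
      (use Suc.prems fn in \<open>auto intro!: C_on_add assms IH\<close>)
qed

lemmas C_on_mult = C_on_bilinear[OF bounded_bilinear_mult]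
  and C_on_scaleR = C_on_bilinear[OF bounded_bilinear_scaleR]

lemma C_on_compose_linear:
  assumes "bounded_linear L" "open S" "C_on n S f"
  shows "C_on n S (\<lambda>x. L (f x))"
  using assms(3)
proof (induction n arbitrary: f)
  case 0
  then show ?case using assms(1) linear_continuous_on bounded_linear.continuous_on by auto
next
  case (Suc n)
  show ?case
    by (rule C_on_Suc_has_derivativeI[OF assms(2)
          bounded_linear.has_derivative[OF assms(1) C_on_Suc_has_derivative[OF Suc.prems]]])
      (use Suc in auto)
qed

lemma C_on_Pair:
  assumes "open S" "C_on n S f" "C_on n S g"
  shows "C_on n S (\<lambda>x. (f x, g x))"
proof -
  have "bounded_linear (\<lambda>a::'b. (a, 0::'c))" "bounded_linear (\<lambda>b::'c. (0::'b, b))"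
    by (auto intro!: bounded_linear_Pair bounded_linear_ident bounded_linear_zero)
  from C_on_add[OF assms(1) C_on_compose_linear[OF this(1) assms(1,2)]
      C_on_compose_linear[OF this(2) assms(1,3)]]
  show ?thesis by simp
qed

lemma C_on_vec:
  fixes f :: "'a::euclidean_space \<Rightarrow> 'b::euclidean_space ^ 'm"
  assumes "open S" "\<And>i. C_on n S (\<lambda>x. f x $ i)"
  shows "C_on n S f"
proof -
  have "bounded_linear (axis i :: 'b \<Rightarrow> 'b ^ 'm)" for i
    by (intro linear_conv_bounded_linear[THEN iffD1] linearI) (simp_all add: vec_eq_iff axis_def)
  from C_on_compose_linear[OF this assms]
  have "C_on n S (\<lambda>x. \<Sum>i\<in>UNIV. axis i (f x $ i))"
    by (intro C_on_sum assms(1))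
  moreover have "(\<Sum>i\<in>UNIV. axis i (v $ i)) = v" for v :: "'b ^ 'm"
    by (simp add: vec_eq_iff axis_def)
  ultimately show ?thesis by simp
qed

text \<open>In the chain rule the direction in which \<open>g\<close> is differentiated varies with
  \<open>x\<close>, whereas \<open>C_on\<close> controls fixed directions only. Expanding that
  direction in \<open>Basis\<close> leaves scalar functions times derivatives of \<open>g\<close> in
  fixed directions.\<close>

lemma C_on_compose:
  fixes f :: "'a::euclidean_space \<Rightarrow> 'b::euclidean_space" and g :: "'b \<Rightarrow> 'c::real_normed_vector"
  assumes "open S" "open T" "f ` S \<subseteq> T" "C_on n S f" "C_on n T g"
  shows "C_on n S (\<lambda>x. g (f x))"
  using assms(4,5)
proof (induction n arbitrary: g)
  case 0
  then show ?case using continuous_on_compose2 assms(3) by auto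
next
  case (Suc n)
  let ?f' = "\<lambda>x. frechet_derivative f (at x)" and ?g' = "\<lambda>y. frechet_derivative g (at y)"
  have der: "((\<lambda>x. g (f x)) has_derivative (\<lambda>v. \<Sum>b\<in>Basis. (?f' x v \<bullet> b) *\<^sub>R ?g' (f x) b)) (at x)"
    if "x \<in> S" for x
  proof -
    have g: "(g has_derivative ?g' (f x)) (at (f x))"
      using C_on_Suc_has_derivative[OF Suc.prems(2)] assms(3) that by blast
    have "(\<Sum>b\<in>Basis. (w \<bullet> b) *\<^sub>R ?g' (f x) b) = ?g' (f x) w" for w
      using linear_sum[OF has_derivative_linear[OF g], of "\<lambda>b. (w \<bullet> b) *\<^sub>R b" Basis]
        linear_scale[OF has_derivative_linear[OF g]]
      by (simp add: euclidean_representation)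
    then show ?thesis
      using has_derivative_compose[OF C_on_Suc_has_derivative[OF Suc.prems(1) that] g] by simp
  qed
  have C: "C_on n S (\<lambda>x. \<Sum>b\<in>Basis. (?f' x v \<bullet> b) *\<^sub>R ?g' (f x) b)" for v
    using Suc.prems C_on_SucD[OF Suc.prems(1)]
    by (intro C_on_sum C_on_scaleR Suc.IH C_on_compose_linear[OF bounded_linear_inner_left] assms)
      auto
  show ?case by (rule C_on_Suc_has_derivativeI[OF assms(1)], erule der, rule C)
qed

text \<open>Differentiation exchanges sine and cosine, so the induction must carry both.\<close>

lemma C_on_sin_cos:
  fixes f :: "'a::euclidean_space \<Rightarrow> real"
  assumes "open S" "C_on n S f"
  shows "C_on n S (\<lambda>x. sin (f x)) \<and> C_on n S (\<lambda>x. cos (f x))"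
  using assms(2)
proof (induction n)
  case 0
  then show ?case by (auto intro: continuous_on_sin continuous_on_cos)
next
  case (Suc n)
  note IH = Suc.IH[OF C_on_SucD[OF Suc.prems]] and D = C_on_Suc_has_derivative[OF Suc.prems]
  have f': "C_on n S (\<lambda>x. frechet_derivative f (at x) v)" for v using Suc.prems by simp
  have "C_on n S (\<lambda>x. cos (f x) * frechet_derivative f (at x) v)"
    "C_on n S (\<lambda>x. (-1) * (sin (f x) * frechet_derivative f (at x) v))" for v
    using IH by (intro C_on_mult C_on_const f' assms(1); simp)+
  then show ?case
    by (intro conjI C_on_Suc_has_derivativeI[OF assms(1)])
      (auto intro!: derivative_eq_intros D simp: mult_ac)
qed

lemmas C_on_sin = C_on_sin_cos[THEN conjunct1]
  and C_on_cos = C_on_sin_cos[THEN conjunct2]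

lemma C_on_inverse:
  fixes f :: "'a::euclidean_space \<Rightarrow> real"
  assumes "open S" "\<And>x. x \<in> S \<Longrightarrow> f x \<noteq> 0" "C_on n S f"
  shows "C_on n S (\<lambda>x. inverse (f x))"
  using assms(3)
proof (induction n)
  case 0
  then show ?case using assms(2) by (auto intro: continuous_on_inverse)
next
  case (Suc n)
  note IH = Suc.IH[OF C_on_SucD[OF Suc.prems]] and D = C_on_Suc_has_derivative[OF Suc.prems]
  have f': "C_on n S (\<lambda>x. frechet_derivative f (at x) v)" for v using Suc.prems by simp
  have "C_on n S (\<lambda>x. (-1) * (inverse (f x) * frechet_derivative f (at x) v * inverse (f x)))" for v
    using IH by (intro C_on_mult C_on_const f' assms(1))
  then show ?case
    by (intro C_on_Suc_has_derivativeI[OF assms(1)])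
      (auto intro!: derivative_eq_intros D simp: assms(2))
qed

lemma C_on_prod:
  fixes f :: "'i \<Rightarrow> 'a::euclidean_space \<Rightarrow> real"
  assumes "open S" "\<And>i. i \<in> I \<Longrightarrow> C_on n S (f i)"
  shows "C_on n S (\<lambda>x. \<Prod>i\<in>I. f i x)"
  using assms(2)
  by (induction I rule: infinite_finite_induct) (auto intro!: C_on_const C_on_mult assms(1))

lemma C_on_det:
  fixes A :: "'a::euclidean_space \<Rightarrow> real ^ 'm ^ 'm"
  assumes "open S" "\<And>i j. C_on n S (\<lambda>x. A x $ i $ j)"
  shows "C_on n S (\<lambda>x. det (A x))"
  unfolding det_def by (intro C_on_sum C_on_mult C_on_prod C_on_const assms)

section \<open>A smooth implicit function theorem\<close>

text \<open>Cramer's rule writes each coordinate of the solution as a quotient of determinants,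
  which are polynomial in the entries of \<open>A\<close> and \<open>b\<close>.\<close>

lemma C_on_cramer:
  fixes A :: "'a::euclidean_space \<Rightarrow> real ^ 'm ^ 'm" and x b :: "'a \<Rightarrow> real ^ 'm"
  assumes "open S" "\<And>i j. C_on n S (\<lambda>p. A p $ i $ j)" "\<And>i. C_on n S (\<lambda>p. b p $ i)"
    and "\<And>p. p \<in> S \<Longrightarrow> det (A p) \<noteq> 0" "\<And>p. p \<in> S \<Longrightarrow> A p *v x p = b p"
  shows "C_on n S x"
proof -
  let ?B = "\<lambda>k p. (\<chi> i j. if j = k then b p $ i else A p $ i $ j) :: real ^ 'm ^ 'm"
  have "C_on n S (\<lambda>p. det (?B k p) * inverse (det (A p)))" for k
  proof (intro C_on_mult C_on_inverse C_on_det assms)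
    show "C_on n S (\<lambda>p. ?B k p $ i $ j)" for i j
      using assms by (cases "j = k") auto
  qed
  moreover have "x p $ k = det (?B k p) * inverse (det (A p))" if "p \<in> S" for p k
    using cramer[OF assms(4)[OF that]] assms(5)[OF that] by (simp add: divide_inverse)
  ultimately show ?thesis
    by (intro C_on_vec C_on_cong[OF assms(1), of "\<lambda>p. x p $ _"]) (use assms in auto)
qed

text \<open>The inverse function theorem for \<open>G (p, x) = (p, f (p, x))\<close> yields a
  differentiable \<open>\<phi>\<close>. Smoothness follows by bootstrapping, since the derivative of
  \<open>\<phi>\<close> solves a linear system whose coefficients are as regular as
  \<open>\<phi>\<close>.\<close>

theorem smooth_implicit_function:
  fixes f :: "'p::euclidean_space \<times> (real ^ 'm) \<Rightarrow> real ^ 'm"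
  assumes U: "open U" and z0: "(p0, x0) \<in> U" and f: "smooth_on U f" and f0: "f (p0, x0) = 0"
    and der: "(f has_derivative f') (at (p0, x0))" and inj: "\<And>w. f' (0, w) = 0 \<Longrightarrow> w = 0"
  obtains P \<phi> where "open P" "p0 \<in> P" "smooth_on P \<phi>" "\<phi> p0 = x0"
    "\<And>p. p \<in> P \<Longrightarrow> (p, \<phi> p) \<in> U \<and> f (p, \<phi> p) = 0"
proof -
  define D where "D z = frechet_derivative f (at z)" for z
  have C: "C_on n U f" for n using f by (simp add: smooth_on_def)
  have D: "(f has_derivative D z) (at z)" if "z \<in> U" for z
    using C_on_Suc_has_derivative[OF C that] by (simp add: D_def)
  have CD: "C_on n U (\<lambda>z. D z v)" for n v
    using C[of "Suc n"] unfolding D_def C_on.simps by blast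
  define G where "G z = (fst z, f z)" for z
  \<comment> \<open>The inverse function theorem takes the derivative as a continuous map into
    bounded linear operators; in finite dimension continuity can be checked one direction at a
    time.\<close>
  define G' where "G' z = Blinfun (\<lambda>h. (fst h, D z h))" for z
  have G_der: "(G has_derivative (\<lambda>h. (fst h, D z h))) (at z)" if "z \<in> U" for z
    unfolding G_def by (intro has_derivative_Pair has_derivative_fst has_derivative_ident D that)
  have G'_apply: "blinfun_apply (G' z) = (\<lambda>h. (fst h, D z h))" if "z \<in> U" for z
    using has_derivative_bounded_linear[OF G_der[OF that]] by (simp add: G'_def bounded_linear_Blinfun_apply)
  have contG': "continuous_on U G'"
  proof (rule continuous_on_blinfun_componentwise)
    fix i :: "'p \<times> (real ^ 'm)"
    have "continuous_on U (\<lambda>z. (fst i, D z i))"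
      using CD[of 0] by (intro continuous_intros) simp
    then show "continuous_on U (\<lambda>z. blinfun_apply (G' z) i)"
      using G'_apply by (simp cong: continuous_on_cong)
  qed
  have "D (p0, x0) = f'" using D[OF z0] der has_derivative_unique by blast
  \<comment> \<open>A kernel vector has first component zero, so \<open>inj\<close> applies to its
    second component.\<close>
  then have "h = 0" if "blinfun_apply (G' (p0, x0)) h = 0" for h
    using that inj[of "snd h"] by (cases h) (simp add: G'_apply[OF z0] zero_prod_def)
  moreover have linG': "linear (blinfun_apply (G' (p0, x0)))"
    by (simp add: blinfun.bounded_linear_right bounded_linear.linear)
  ultimately have "inj (blinfun_apply (G' (p0, x0)))"
    by (subst linear_injective_0) auto
  then obtain L where L: "linear L" "L \<circ> blinfun_apply (G' (p0, x0)) = id"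
    using linear_injective_left_inverse[OF linG'] by auto
  have inv: "Blinfun L o\<^sub>L G' (p0, x0) = id_blinfun"
    using L(1) fun_cong[OF L(2)] by (intro blinfun_eqI)
      (simp add: bounded_linear_Blinfun_apply linear_conv_bounded_linear del: split_paired_All)
  have G_blinfun: "(G has_derivative blinfun_apply (G' z)) (at z)" if "z \<in> U" for z
    using G_der[OF that] by (simp add: G'_apply[OF that])
  obtain U' V g g' where IFT: "open U'" "U' \<subseteq> U" "(p0, x0) \<in> U'" "open V" "G (p0, x0) \<in> V"
    "homeomorphism U' V G g" "\<And>y. y \<in> V \<Longrightarrow> (g has_derivative g' y) (at y)"
    "\<And>y. y \<in> V \<Longrightarrow> g' y = inv (blinfun_apply (G' (g y)))"
    "\<And>y. y \<in> V \<Longrightarrow> bij (blinfun_apply (G' (g y)))"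
    by (rule inverse_function_theorem[OF U G_blinfun contG' z0 inv]) (assumption, rule that)
  define \<phi> where "\<phi> p = snd (g (p, 0))" for p
  define P where "P = (\<lambda>p. (p, 0)) -` V"
  have openP: "open P"
    unfolding P_def using IFT(4) by (intro open_vimage) (auto intro!: continuous_intros)
  have p0: "p0 \<in> P" using IFT(5) f0 by (simp add: P_def G_def)
  have g_eq: "g (p, 0) = (p, \<phi> p)" and zero: "(p, \<phi> p) \<in> U" "f (p, \<phi> p) = 0" if "p \<in> P" for p
  proof -
    have V: "(p, 0) \<in> V" using that by (simp add: P_def)
    have G: "G (g (p, 0)) = (p, 0)" using IFT(6) V by (simp add: homeomorphism_def)
    then show eq: "g (p, 0) = (p, \<phi> p)" by (simp add: G_def \<phi>_def prod_eq_iff)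
    show "f (p, \<phi> p) = 0" using G by (simp add: eq G_def)
    have "g (p, 0) \<in> U'" using IFT(6) V by (auto simp: homeomorphism_def)
    then show "(p, \<phi> p) \<in> U" using IFT(2) eq by auto
  qed
  have "\<phi> p0 = x0"
    using IFT(3,6) f0 by (simp add: \<phi>_def homeomorphism_def G_def) (metis fst_conv snd_conv)
  define \<phi>' where "\<phi>' p u = snd (g' (p, 0) (u, 0))" for p u
  have \<phi>_der: "(\<phi> has_derivative \<phi>' p) (at p)" if "p \<in> P" for p
  proof -
    have "((\<lambda>p. (p, 0::real ^ 'm)) has_derivative (\<lambda>u. (u, 0))) (at p)"
      by (intro derivative_eq_intros) auto
    from has_derivative_compose[OF this IFT(7)] that
    have "((\<lambda>p. g (p, 0)) has_derivative (\<lambda>u. g' (p, 0) (u, 0))) (at p)" by (simp add: P_def)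
    then show ?thesis unfolding \<phi>_def \<phi>'_def by (rule has_derivative_snd)
  qed
  have lin: "linear (D z)" if "z \<in> U" for z using D[OF that] has_derivative_linear by blast
  \<comment> \<open>The partial derivative of \<open>f\<close> in the unknown, along the graph of
    \<open>\<phi>\<close>.\<close>
  define A where "A p = matrix (\<lambda>w. D (p, \<phi> p) (0, w))" for p
  have linA: "linear (\<lambda>w. D (p, \<phi> p) (0, w))" if "p \<in> P" for p
    using linear_compose[OF _ lin[OF zero(1)[OF that]], of "\<lambda>w. (0, w)"]
    by (simp add: o_def linear_iff)
  have A_mul: "A p *v w = D (p, \<phi> p) (0, w)" if "p \<in> P" for p w
    unfolding A_def by (rule matrix_vector_mul(2)[OF linA[OF that], THEN fun_cong])
  \<comment> \<open>Bijectivity of the derivative of \<open>G\<close> holds at all points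
    \<open>g y\<close> with \<open>y\<close> in \<open>V\<close>, and that derivative sends
    \<open>(0, w)\<close> to \<open>(0, A p *v w)\<close>; hence invertibility on all of
    \<open>P\<close>.\<close>
  have detA: "det (A p) \<noteq> 0" if "p \<in> P" for p
  proof -
    have "inj (blinfun_apply (G' (p, \<phi> p)))"
      using IFT(9)[of "(p, 0)"] that g_eq[OF that] by (simp add: P_def bij_is_inj)
    then have "inj ((*v) (A p))"
      by (auto simp: inj_on_def G'_apply[OF zero(1)[OF that]] A_mul[OF that])
    then show ?thesis using invertible_det_nz invertible_left_inverse matrix_left_invertible_injective by blast
  qed
  \<comment> \<open>Obtained by differentiating the identity \<open>f (p, \<phi> p) = 0\<close> in
    the direction \<open>u\<close>.\<close>
  have sys: "A p *v \<phi>' p u = - D (p, \<phi> p) (u, 0)" if "p \<in> P" for p u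
  proof -
    have "((\<lambda>p. f (p, \<phi> p)) has_derivative (\<lambda>u. D (p, \<phi> p) (u, \<phi>' p u))) (at p)"
      by (rule has_derivative_compose[where f = "\<lambda>p. (p, \<phi> p)" and g = f])
        (intro has_derivative_Pair has_derivative_ident \<phi>_der D zero that)+
    moreover have "((\<lambda>p. f (p, \<phi> p)) has_derivative (\<lambda>u. 0)) (at p)"
      by (rule has_derivative_transform_within_open[OF has_derivative_const openP that])
        (simp add: zero)
    ultimately have "(\<lambda>u. D (p, \<phi> p) (u, \<phi>' p u)) = (\<lambda>u. 0)" by (rule has_derivative_unique)
    then have "D (p, \<phi> p) (u, \<phi>' p u) = 0" by (rule fun_cong)
    moreover have "D (p, \<phi> p) (u, \<phi>' p u) = D (p, \<phi> p) (u, 0) + D (p, \<phi> p) (0, \<phi>' p u)"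
      using linear_add[OF lin[OF zero(1)[OF that]], of "(u, 0)" "(0, \<phi>' p u)"] by simp
    ultimately show ?thesis
      by (metis A_mul[OF that] add.commute eq_neg_iff_add_eq_0)
  qed
  have "C_on n P \<phi>" for n
  proof (induction n)
    case 0
    then show ?case
      by (auto intro!: continuous_at_imp_continuous_on has_derivative_continuous[OF \<phi>_der])
  next
    \<comment> \<open>Once \<open>\<phi>\<close> is of class \<open>n\<close>, so are both sides'
      coefficients in \<open>sys\<close>; Cramer's rule then makes \<open>\<phi>'\<close> of class
      \<open>n\<close>.\<close>
    case (Suc n)
    have Dz: "C_on n P (\<lambda>p. D (p, \<phi> p) v $ i)" for v i
      by (rule C_on_compose_linear[OF bounded_linear_vec_nth openP])
        (use zero in \<open>intro C_on_compose[OF openP U _ _ CD] C_on_Pair openP Suc.IH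
          C_on_bounded_linear bounded_linear_ident; auto\<close>)
    have C: "C_on n P (\<lambda>p. \<phi>' p u)" for u
    proof (rule C_on_cramer[OF openP _ _ detA sys])
      show "C_on n P (\<lambda>p. A p $ i $ j)" for i j using Dz by (simp add: A_def matrix_def)
      have "C_on n P (\<lambda>p. (-1) * D (p, \<phi> p) (u, 0) $ i)" for i
        by (intro C_on_mult C_on_const openP Dz)
      then show "C_on n P (\<lambda>p. (- D (p, \<phi> p) (u, 0)) $ i)" for i by simp
    qed
    show ?case by (rule C_on_Suc_has_derivativeI[OF openP], erule \<phi>_der, rule C)
  qed
  then have "smooth_on P \<phi>" by (simp add: smooth_on_def)
  then show thesis using that[of P \<phi>] openP p0 \<open>\<phi> p0 = x0\<close> zero by blast
qed

section \<open>Solving the system\<close>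

lemma rat_independent_coords_approximation:
  fixes w :: "real ^ 'n" and \<alpha> :: "'n \<Rightarrow> real"
  assumes "rat_independent_coords w" "\<epsilon> > 0"
  obtains t h where "\<And>j. \<bar>t * w $ j - of_int (h j) - \<alpha> j\<bar> < \<epsilon>"
proof -
  interpret Q: vector_space "\<lambda>(q::rat) (x::real). of_rat q * x"
    by (rule vector_space_rat_real)
  interpret Z: Modules.module "\<lambda>(r::int) (x::real). of_int r * x"
    by (simp add: Modules.module.intro distrib_left mult.commute)
  obtain e :: "nat \<Rightarrow> 'n" where e: "bij_betw e {..<CARD('n)} UNIV"
    using ex_bij_betw_nat_finite[of "UNIV :: 'n set"] by (auto simp: atLeast0LessThan)
  define \<theta> where "\<theta> i = w $ e i" for i
  have rng: "\<theta> ` {..<CARD('n)} = range (\<lambda>j. w $ j)"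
    using e unfolding \<theta>_def bij_betw_def by (metis image_image)
  \<comment> \<open>Kronecker's theorem is applied with independence over the integers; an integer
    relation is in particular a rational one.\<close>
  have "Z.independent (range (\<lambda>j. w $ j))"
  proof
    assume "Z.dependent (range (\<lambda>j. w $ j))"
    then obtain T u v where "finite T" "T \<subseteq> range (\<lambda>j. w $ j)" "(\<Sum>v\<in>T. of_int (u v) * v) = 0"
      "v \<in> T" "u v \<noteq> 0"
      unfolding Z.dependent_explicit by blast
    then have "Q.dependent (range (\<lambda>j. w $ j))"
      unfolding Q.dependent_explicit
      by (intro exI[of _ T] exI[of _ "\<lambda>v. of_int (u v)"]) auto
    then show False using assms(1) by (simp add: rat_independent_coords_def)
  qed
  moreover have "inj_on \<theta> {..<CARD('n)}"
    using e assms(1) unfolding \<theta>_def rat_independent_coords_def bij_betw_def inj_on_def by blast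
  ultimately obtain t h
    where th: "\<And>i. i < CARD('n) \<Longrightarrow> \<bar>t * \<theta> i - of_int (h i) - \<alpha> (e i)\<bar> < \<epsilon>"
    using Kronecker_thm_1[of \<theta> "CARD('n)" \<epsilon> "\<lambda>i. \<alpha> (e i)"] assms(2) unfolding rng by blast
  show thesis
  proof
    fix j
    obtain i where "i < CARD('n)" "e i = j"
      using e by (metis UNIV_I bij_betwE bij_betw_imp_surj_on imageE lessThan_iff)
    then show "\<bar>t * w $ j - of_int (h (inv_into {..<CARD('n)} e j)) - \<alpha> j\<bar> < \<epsilon>"
      using th e by (auto simp: \<theta>_def bij_betw_def)
  qed
qed

lemma has_derivative_vec:
  fixes f :: "'a::real_normed_vector \<Rightarrow> real ^ 'm"
  assumes "\<And>i. ((\<lambda>x. f x $ i) has_derivative (\<lambda>h. f' h $ i)) (at x)"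
  shows "(f has_derivative f') (at x)"
  using assms by (subst has_derivative_componentwise_within) (auto simp: Basis_vec_def inner_axis)

section \<open>An invertible sign matrix\<close>

text \<open>The exceptional index \<open>i0\<close> keeps the matrix invertible in every dimension:
  with \<open>-1\<close> on the whole diagonal it would be singular in dimension two.\<close>

definition sign_mat :: "'n \<Rightarrow> 'n \<Rightarrow> 'n \<Rightarrow> real" where
  "sign_mat i0 j k = (if j = k \<and> j \<noteq> i0 then -1 else 1)"

lemma sum_sign_mat:
  fixes v :: "'n::finite \<Rightarrow> real"
  shows "(\<Sum>k\<in>UNIV. sign_mat i0 j k * v k) = (\<Sum>k\<in>UNIV. v k) - (if j = i0 then 0 else 2 * v j)"
proof -
  have "(\<Sum>k\<in>UNIV. sign_mat i0 j k * v k)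
      = (\<Sum>k\<in>UNIV. v k - (if j = k then if j = i0 then 0 else 2 * v j else 0))"
    by (rule sum.cong) (auto simp: sign_mat_def)
  then show ?thesis by (simp add: sum_subtractf)
qed

text \<open>Row \<open>i0\<close> says that the sum of \<open>v\<close> vanishes; every other row
  then reduces to \<open>2 * v j = 0\<close>.\<close>

lemma sign_mat_injective:
  fixes v :: "'n::finite \<Rightarrow> real"
  assumes "\<And>j. (\<Sum>k\<in>UNIV. sign_mat i0 j k * v k) = 0"
  shows "v k = 0"
proof -
  have S: "(\<Sum>k\<in>UNIV. v k) = 0" using assms[of i0] by (simp add: sum_sign_mat)
  have "v j = 0" if "j \<noteq> i0" for j using assms[of j] S that by (simp add: sum_sign_mat)
  moreover from this S have "v i0 = 0" by (simp add: sum.remove[of UNIV i0])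
  ultimately show ?thesis by metis
qed

text \<open>Subtracting row \<open>j\<close> from row \<open>i0\<close> forces
  \<open>a j = (w $ j - w $ i0) / 2\<close>, nonzero since the coordinates are distinct. Row
  \<open>i0\<close> then fixes \<open>a i0\<close>, a nontrivial rational combination of the
  coordinates.\<close>

lemma sign_mat_solution:
  fixes w :: "real ^ 'n"
  assumes "rat_independent_coords w"
  obtains a :: "'n \<Rightarrow> real"
  where "\<And>k. a k \<noteq> 0" "\<And>j. (\<Sum>k\<in>UNIV. sign_mat i0 j k * a k) = - w $ j"
proof -
  define S where "S = (\<Sum>i\<in>UNIV - {i0}. (w $ i - w $ i0) / 2)"
  define a where "a k = (if k = i0 then - w $ i0 - S else (w $ k - w $ i0) / 2)" for k
  have a_i0: "a i0 = - w $ i0 - S" by (simp add: a_def)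
  have rest: "(\<Sum>k\<in>UNIV - {i0}. a k) = S" unfolding S_def by (rule sum.cong) (auto simp: a_def)
  have "(\<Sum>k\<in>UNIV. a k) = - w $ i0"
    using rest sum.remove[of UNIV i0 a] by (simp add: a_i0)
  then have "(\<Sum>k\<in>UNIV. sign_mat i0 j k * a k) = - w $ j" for j
    unfolding sum_sign_mat by (cases "j = i0") (simp_all add: a_def diff_divide_distrib)
  moreover have "a k \<noteq> 0" for k
  proof (cases "k = i0")
    case False
    then show ?thesis
      using assms by (auto simp: a_def rat_independent_coords_def dest: injD)
  next
    case True
    \<comment> \<open>The coefficients of \<open>a i0\<close> as a rational combination of the
      coordinates of \<open>w\<close>.\<close>
    define q :: "'n \<Rightarrow> rat"
      where "q i = (if i = i0 then - 1 + of_nat (card (UNIV - {i0})) / 2 else - 1 / 2)" for i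
    have "(\<Sum>i\<in>UNIV - {i0}. of_rat (q i) * w $ i) = (\<Sum>i\<in>UNIV - {i0}. - (w $ i / 2))"
      by (rule sum.cong) (auto simp: q_def of_rat_divide of_rat_minus)
    moreover have "real_of_rat (q i0) = - 1 + of_nat (card (UNIV - {i0})) / 2"
      by (simp add: q_def of_rat_add of_rat_divide of_rat_diff of_rat_minus)
    ultimately have "(\<Sum>i\<in>UNIV. of_rat (q i) * w $ i)
        = (- 1 + of_nat (card (UNIV - {i0})) / 2) * w $ i0 + (\<Sum>i\<in>UNIV - {i0}. - (w $ i / 2))"
      using sum.remove[of UNIV i0 "\<lambda>i. of_rat (q i) * w $ i"] by simp
    also have "\<dots> = - w $ i0 - S"
      by (simp add: S_def sum_negf sum_subtractf diff_divide_distrib algebra_simps)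
    finally have eq: "(\<Sum>i\<in>UNIV. of_rat (q i) * w $ i) = a k" using True by (simp add: a_def)
    \<comment> \<open>In dimension three \<open>q i0\<close> vanishes, so another index serves as
      witness whenever there is one; in dimension one \<open>q i0 = -1\<close>.\<close>
    have "\<exists>i. q i \<noteq> 0"
    proof (cases "UNIV - {i0} = {}")
      case True
      then have "q i0 \<noteq> 0" by (simp only: q_def) simp
      then show ?thesis ..
    next
      case False
      then obtain i where "i \<noteq> i0" by auto
      then have "q i \<noteq> 0" by (simp add: q_def)
      then show ?thesis ..
    qed
    with eq show ?thesis using assms rat_independent_coords_iff by fastforce
  qed
  ultimately show thesis by (rule that[rotated])
qed

section \<open>The parametrized real system and its linearization\<close>

text \<open>
  The unknowns \<open>x\<close> are the corrections \<open>s\<^sub>k\<close> of the delays (left summand) and the amplitudes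
  \<open>a\<^sub>k\<close> (right summand); the parameters are the phases \<open>b $ j $ k\<close>, which stand for
  \<open>\<omega>\<^sub>j T\<^sub>k\<close> modulo \<open>2 \<pi>\<close> with large delays \<open>T\<^sub>k\<close>, and the frequencies \<open>w\<close>.
\<close>

definition phase_eq :: "((real ^ 'n ^ 'n) \<times> (real ^ 'n)) \<times> (real ^ ('n + 'n)) \<Rightarrow> real ^ ('n + 'n)" where
  "phase_eq = (\<lambda>((b, w), x). \<chi> i. case i of
     Inl j \<Rightarrow> \<Sum>k\<in>UNIV. x $ Inr k * cos (b $ j $ k + w $ j * x $ Inl k)
   | Inr j \<Rightarrow> (\<Sum>k\<in>UNIV. x $ Inr k * sin (b $ j $ k + w $ j * x $ Inl k)) + w $ j)"

lemma phase_eq_nth: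
  "phase_eq z $ Inl j =
     (\<Sum>k\<in>UNIV. snd z $ Inr k * cos (fst (fst z) $ j $ k + snd (fst z) $ j * snd z $ Inl k))"
  "phase_eq z $ Inr j =
     (\<Sum>k\<in>UNIV. snd z $ Inr k * sin (fst (fst z) $ j $ k + snd (fst z) $ j * snd z $ Inl k))
       + snd (fst z) $ j"
  by (simp_all add: phase_eq_def split_beta)

lemma smooth_on_phase_eq: "smooth_on UNIV (phase_eq :: _ \<Rightarrow> real ^ ('n::finite + 'n))"
  unfolding smooth_on_def
proof (intro allI C_on_vec open_UNIV)
  fix n and i :: "'n + 'n"
  have coord: "C_on n UNIV (\<lambda>z::((real ^ 'n ^ 'n) \<times> (real ^ 'n)) \<times> (real ^ ('n + 'n)). fst (fst z) $ j $ k)"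
    "C_on n UNIV (\<lambda>z::((real ^ 'n ^ 'n) \<times> (real ^ 'n)) \<times> (real ^ ('n + 'n)). snd (fst z) $ j)"
    "C_on n UNIV (\<lambda>z::((real ^ 'n ^ 'n) \<times> (real ^ 'n)) \<times> (real ^ ('n + 'n)). snd z $ l)" for j k l
    by (intro C_on_bounded_linear open_UNIV bounded_linear_compose[OF bounded_linear_vec_nth]
        bounded_linear_fst_comp bounded_linear_snd_comp bounded_linear_fst bounded_linear_snd)+
  show "C_on n UNIV (\<lambda>z::((real ^ 'n ^ 'n) \<times> (real ^ 'n)) \<times> (real ^ ('n + 'n)). phase_eq z $ i)"
    by (cases i; simp only: phase_eq_nth;
        intro C_on_sum C_on_mult C_on_add C_on_sin C_on_cos coord open_UNIV)
qed

text \<open>The first argument is the base point and the second the direction, so that the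
  linearization in the unknowns is the restriction to directions \<open>(0, v)\<close>.\<close>

definition phase_eq' ::
  "((real ^ 'n ^ 'n) \<times> (real ^ 'n)) \<times> (real ^ ('n + 'n)) \<Rightarrow>
   ((real ^ 'n ^ 'n) \<times> (real ^ 'n)) \<times> (real ^ ('n + 'n)) \<Rightarrow> real ^ ('n + 'n)" where
  "phase_eq' = (\<lambda>((b, w), x) ((b', w'), x'). \<chi> i. case i of
     Inl j \<Rightarrow> \<Sum>k\<in>UNIV. x' $ Inr k * cos (b $ j $ k + w $ j * x $ Inl k)
       - x $ Inr k * sin (b $ j $ k + w $ j * x $ Inl k)
         * (b' $ j $ k + w' $ j * x $ Inl k + w $ j * x' $ Inl k)
   | Inr j \<Rightarrow> (\<Sum>k\<in>UNIV. x' $ Inr k * sin (b $ j $ k + w $ j * x $ Inl k)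
       + x $ Inr k * cos (b $ j $ k + w $ j * x $ Inl k)
         * (b' $ j $ k + w' $ j * x $ Inl k + w $ j * x' $ Inl k)) + w' $ j)"

lemma has_derivative_phase_eq:
  fixes z :: "((real ^ 'n ^ 'n) \<times> (real ^ 'n)) \<times> (real ^ ('n + 'n))"
  shows "(phase_eq has_derivative phase_eq' z) (at z)"
proof (rule has_derivative_vec)
  fix i :: "'n + 'n"
  have nth: "((\<lambda>x. f x $ j) has_derivative (\<lambda>h. f' h $ j)) (at z)"
    if "(f has_derivative f') (at z)" for f f' and j
    using that by (rule bounded_linear.has_derivative[OF bounded_linear_vec_nth])
  show "((\<lambda>z. phase_eq z $ i) has_derivative (\<lambda>h. phase_eq' z h $ i)) (at z)"
    by (cases i)
      (auto simp: phase_eq_nth phase_eq'_def split_beta algebra_simps intro!: derivative_eq_intros nth sum.cong)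
qed

section \<open>Construction of the neighborhood and of the map\<close>

theorem theorem2p2:
  fixes \<omega>0 :: "real ^ 'n"
  assumes pos: "\<And>j. \<omega>0 $ j > 0"
    and indep: "rat_independent_coords \<omega>0"
  shows "\<exists>(N :: (real ^ 'n) set) (H :: real ^ 'n \<Rightarrow> (real ^ 'n) \<times> (real ^ 'n)) \<tau> A.
    open N \<and> \<omega>0 \<in> N \<and> smooth_on N H \<and>
    (\<forall>\<omega>\<in>N. H \<omega> = (\<tau> \<omega>, A \<omega>) \<and>
      (\<forall>j.
        (\<Sum>k\<in>UNIV. complex_of_real (A \<omega> $ k) * exp (- \<i> * complex_of_real (\<omega> $ j * \<tau> \<omega> $ k)))
          = \<i> * complex_of_real (\<omega> $ j) \<and>
        (\<Sum>k\<in>UNIV. complex_of_real (A \<omega> $ k) * exp (\<i> * complex_of_real (\<omega> $ j * \<tau> \<omega> $ k)))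
          = - \<i> * complex_of_real (\<omega> $ j)))"
proof -
  \<comment> \<open>Any index may be the exceptional one, so an arbitrary value is taken.\<close>
  define M where "M = sign_mat (undefined :: 'n)"
  obtain a where a0: "\<And>k. a k \<noteq> 0" and a: "\<And>j. (\<Sum>k\<in>UNIV. M j k * a k) = - \<omega>0 $ j"
    unfolding M_def using sign_mat_solution[OF indep] by blast
  define b0 :: "real ^ 'n ^ 'n" where "b0 = (\<chi> j k. M j k * (pi / 2))"
  define x0 :: "real ^ ('n + 'n)" where "x0 = (\<chi> i. case i of Inl k \<Rightarrow> 0 | Inr k \<Rightarrow> a k)"
  have trig: "sin (b0 $ j $ k) = M j k" "cos (b0 $ j $ k) = 0" for j k
    by (auto simp: b0_def M_def sign_mat_def)
  have zero: "phase_eq ((b0, \<omega>0), x0) = 0"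
  proof -
    have "phase_eq ((b0, \<omega>0), x0) $ i = 0" for i
      using a by (cases i) (simp_all add: phase_eq_nth x0_def trig mult.commute)
    then show ?thesis by (simp add: vec_eq_iff)
  qed
  \<comment> \<open>At the base point the cosines vanish and the sines are \<open>M j k\<close>. The
    sine rows thus involve only the amplitude part of \<open>v\<close>, and the cosine rows only the
    delay part, with factors \<open>\<omega>0 $ j\<close> and \<open>a k\<close> that are
    nonzero.\<close>
  have inj: "v = 0" if "phase_eq' ((b0, \<omega>0), x0) (0, v) = 0" for v
  proof -
    have comp: "phase_eq' ((b0, \<omega>0), x0) (0, v) $ i = 0" for i using that by simp
    have "(\<Sum>k\<in>UNIV. M j k * v $ Inr k) = 0" for j
      using comp[of "Inr j"]
      by (simp add: phase_eq'_def zero_prod_def x0_def trig mult.commute)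
    then have r: "v $ Inr k = 0" for k unfolding M_def by (rule sign_mat_injective)
    have "(\<Sum>k\<in>UNIV. M j k * (a k * v $ Inl k)) = 0" for j
    proof -
      have "\<omega>0 $ j * (\<Sum>k\<in>UNIV. M j k * (a k * v $ Inl k)) = 0"
        using comp[of "Inl j"]
        by (simp add: phase_eq'_def zero_prod_def x0_def trig sum_negf sum_distrib_left mult_ac)
      then show ?thesis using pos[of j] by simp
    qed
    then have "a k * v $ Inl k = 0" for k unfolding M_def by (rule sign_mat_injective)
    then have l: "v $ Inl k = 0" for k using a0 by simp
    have "v $ i = 0" for i using l r by (cases i) auto
    then show ?thesis by (simp add: vec_eq_iff)
  qed
  obtain P \<phi> where P: "open P" "(b0, \<omega>0) \<in> P" "smooth_on P \<phi>"
    and \<phi>: "\<And>p. p \<in> P \<Longrightarrow> phase_eq (p, \<phi> p) = 0"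
    using smooth_implicit_function[OF open_UNIV UNIV_I smooth_on_phase_eq zero
        has_derivative_phase_eq inj] by metis
  obtain e where e: "e > 0" "ball (b0, \<omega>0) e \<subseteq> P" using P openE by blast
  \<comment> \<open>With this bound on each of the \<open>CARD('n) * CARD('n)\<close> entries, the
    norm of the phase error is at most \<open>e / 2\<close>.\<close>
  define d where "d = e / (2 * real CARD('n) * real CARD('n))"
  have d: "d > 0" using e by (simp add: d_def)
  \<comment> \<open>Phases are counted in full turns: \<open>M j k / 4\<close> of a turn is
    \<open>M j k * (pi / 2)\<close>, and the large delay is \<open>2 * pi * t k\<close>.\<close>
  have "\<exists>t h. \<forall>j. \<bar>t * \<omega>0 $ j - of_int (h j) - M j k / 4\<bar> < d / (2 * pi)" for k
    using rat_independent_coords_approximation[OF indep, of "d / (2 * pi)" "\<lambda>j. M j k / 4"] d by force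
  then obtain t h where
    th: "\<And>j k. \<bar>t k * \<omega>0 $ j - real_of_int (h k j) - M j k / 4\<bar> < d / (2 * pi)" by metis
  \<comment> \<open>The integers \<open>h k j\<close> stay fixed while \<open>w\<close> varies, so
    \<open>b\<close> is affine in \<open>w\<close> and hence smooth.\<close>
  define b :: "real ^ 'n \<Rightarrow> real ^ 'n ^ 'n"
    where "b w = (\<chi> j k. 2 * pi * t k * w $ j + - (2 * pi * of_int (h k j)))" for w
  have bd: "\<bar>(b \<omega>0 - b0) $ j $ k\<bar> \<le> d" for j k
  proof -
    have "(b \<omega>0 - b0) $ j $ k = (2 * pi) * (t k * \<omega>0 $ j - real_of_int (h k j) - M j k / 4)"
      by (simp add: b_def b0_def algebra_simps)
    then have "\<bar>(b \<omega>0 - b0) $ j $ k\<bar> = (2 * pi) * \<bar>t k * \<omega>0 $ j - real_of_int (h k j) - M j k / 4\<bar>"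
      by (simp add: abs_mult)
    then show ?thesis using th[of k j] by (simp add: field_simps)
  qed
  have "norm (b \<omega>0 - b0) \<le> (\<Sum>j\<in>UNIV. norm ((b \<omega>0 - b0) $ j))"
    unfolding norm_vec_def by (rule L2_set_le_sum) simp
  also have "\<dots> \<le> (\<Sum>j\<in>(UNIV::'n set). \<Sum>k\<in>(UNIV::'n set). d)"
    by (intro sum_mono order.trans[OF norm_le_l1_cart] bd)
  also have "\<dots> = e / 2" by (simp add: d_def)
  also have "\<dots> < e" using e by simp
  finally have "(b \<omega>0, \<omega>0) \<in> ball (b0, \<omega>0) e"
    by (simp add: dist_Pair_Pair dist_norm norm_minus_commute)
  then have in_P: "(b \<omega>0, \<omega>0) \<in> P" using e by blast
  have C_b_nth: "C_on n UNIV (\<lambda>w. b w $ j $ k)" for n j k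
    by (simp only: b_def vec_lambda_beta, intro C_on_add C_on_mult C_on_const C_on_bounded_linear
        bounded_linear_vec_nth open_UNIV)
  have C_b: "C_on n UNIV (\<lambda>w. (b w, w))" for n
    by (intro C_on_Pair C_on_vec open_UNIV C_b_nth C_on_bounded_linear[OF _ bounded_linear_vec_nth])
  define N where "N = (\<lambda>w. (b w, w)) -` P"
  have N: "open N" unfolding N_def using C_b[of 0] P(1) by (intro open_vimage) simp_all
  define \<psi> where "\<psi> w = \<phi> (b w, w)" for w
  have C_\<psi>: "C_on n N \<psi>" for n
    unfolding \<psi>_def
    by (rule C_on_compose[OF N P(1) _ C_on_subset[OF C_b subset_UNIV]])
      (use P(3) in \<open>auto simp: N_def smooth_on_def\<close>)
  define \<tau> :: "real ^ 'n \<Rightarrow> real ^ 'n" where "\<tau> w = (\<chi> k. 2 * pi * t k + \<psi> w $ Inl k)" for w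
  define A :: "real ^ 'n \<Rightarrow> real ^ 'n" where "A w = (\<chi> k. \<psi> w $ Inr k)" for w
  have "smooth_on N (\<lambda>w. (\<tau> w, A w))"
    unfolding smooth_on_def
    by (intro allI C_on_Pair C_on_vec N)
      (simp_all add: \<tau>_def A_def N C_on_add C_on_const C_on_compose_linear[OF bounded_linear_vec_nth N C_\<psi>])
  moreover have
    "(\<Sum>k\<in>UNIV. complex_of_real (A w $ k) * exp (- \<i> * complex_of_real (w $ j * \<tau> w $ k)))
        = \<i> * complex_of_real (w $ j)"
    "(\<Sum>k\<in>UNIV. complex_of_real (A w $ k) * exp (\<i> * complex_of_real (w $ j * \<tau> w $ k)))
        = - \<i> * complex_of_real (w $ j)" if "w \<in> N" for w j
  proof -
    \<comment> \<open>The true phases differ from those in \<open>phase_eq\<close> by integer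
      multiples of \<open>2 * pi\<close>, which sine and cosine ignore.\<close>
    have "w $ j * \<tau> w $ k = (b w $ j $ k + w $ j * \<psi> w $ Inl k) + 2 * pi * of_int (h k j)" for k
      by (simp add: \<tau>_def b_def algebra_simps)
    then have *: "cos (w $ j * \<tau> w $ k) = cos (b w $ j $ k + w $ j * \<psi> w $ Inl k)"
      "sin (w $ j * \<tau> w $ k) = sin (b w $ j $ k + w $ j * \<psi> w $ Inl k)" for k
      by (simp_all only: cos_add[of "_ + _ * _"] sin_add[of "_ + _ * _"] cos_int_2pin sin_int_2pin)
    have eqs: "phase_eq ((b w, w), \<psi> w) $ i = 0" for i
      using that \<phi> by (simp add: N_def \<psi>_def)
    have "(\<Sum>k\<in>UNIV. A w $ k * cos (w $ j * \<tau> w $ k)) = 0"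
      "(\<Sum>k\<in>UNIV. A w $ k * sin (w $ j * \<tau> w $ k)) = - w $ j"
      using eqs[of "Inl j"] eqs[of "Inr j"] by (simp_all add: phase_eq_nth * A_def)
    \<comment> \<open>The real parts of both equations are the cosine identity; the imaginary parts
      are the sine identity, up to sign.\<close>
    then show
      "(\<Sum>k\<in>UNIV. complex_of_real (A w $ k) * exp (- \<i> * complex_of_real (w $ j * \<tau> w $ k)))
        = \<i> * complex_of_real (w $ j)"
      "(\<Sum>k\<in>UNIV. complex_of_real (A w $ k) * exp (\<i> * complex_of_real (w $ j * \<tau> w $ k)))
        = - \<i> * complex_of_real (w $ j)"
      by (simp_all add: complex_eq_iff Re_exp Im_exp sum_negf)
  qed
  ultimately show ?thesis
    using N in_P by (intro exI[of _ N] exI[of _ "\<lambda>w. (\<tau> w, A w)"] exI[of _ \<tau>] exI[of _ A])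
      (auto simp: N_def)
qed

end
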